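(* Let $\mathcal V_{W\dot WM_uM_y}$ be a generalized dynamical system and $\mathcal V_{W\dot W}$ a genaut. There exists a linear subspace $\mathcal V_{\dot WM_y}$ of vectors on $\dot W\uplus M_y$ such that $$(\mathcal V_{W\dot WM_uM_y}+\mathcal V_{\dot WM_y})\times W\dot W=\mathcal V_{W\dot W}\qquad( * )$$ if and only if $$\mathcal V_{W\dot WM_uM_y}\times W\dot W\subseteq\mathcal V_{W\dot W}\quad\text{and}\quad \mathcal V_{W\dot WM_uM_y}\times W\dot WM_y\circ W\supseteq\mathcal V_{W\dot W}\circ W .$$ Further, if such a $\mathcal V_{\dot WM_y}$ exists, then the subspace $\mathcal V_{\dot WM_y}$ satisfying $( * )$ is unique under the conditions $$\mathcal V_{W\dot WM_uM_y}\times\dot WM_y\subseteq\mathcal V_{\dot WM_y}\quad\text{and}\quad \mathcal V_{W\dot WM_uM_y}\times W\dot WM_y\circ M_y\supseteq\mathcal V_{\dot WM_y}\circ M_y,$$ and it is then equal to $\bigl((\mathcal V_{W\dot WM_uM_y}+I_{\dot W(-\dot W')})\times W\dot W\dot W'M_y\bigr)\leftrightarrow\mathcal V_{W\dot W}$ (a space on $\dot W'\uplus M_y$, with $\dot W'$ identified with $\dot W$), which equals $(\mathcal V_{W\dot WM_uM_y}+\mathcal V_{W\dot W})\times\dot WM_y$.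
   Context: Fix a field $\mathbb F$; all index sets are finite. A vector on $X$ is a function $X\to\mathbb F$. $W,\dot W$ are disjoint sets that are copies of each other (in bijection), and $M_u,M_y$ are further disjoint sets. A generalized dynamical system $\mathcal V_{W\dot WM_uM_y}$ is a linear subspace of vectors on $W\uplus\dot W\uplus M_u\uplus M_y$; a genaut $\mathcal V_{W\dot W}$ is a linear subspace of vectors on $W\uplus\dot W$. For $T\subseteq S$: $\mathcal V_S\circ T$ is the set of restrictions to $T$ of vectors in $\mathcal V_S$; $\mathcal V_S\times T:=\{f_T:(f_T,0_{S\setminus T})\in\mathcal V_S\}$. Such operations are applied left to right, and juxtaposition such as $W\dot WM_y$ means the disjoint union. For spaces on different index sets, $\mathcal V_X+\mathcal V_Y$ is the sum on $X\cup Y$ after extending the vectors of each space by zero. For $Y\subseteq X$, $\mathcal V_X\leftrightarrow\mathcal V_Y:=\{f_{X\setminus Y}:\exists g_Y\in\mathcal V_Y,\ (f_{X\setminus Y},g_Y)\in\mathcal V_X\}$. $\dot W'$ is a further disjoint copy of $\dot W$ and $I_{\dot W(-\dot W')}:=\{(f_{\dot W},-f_{\dot W'}):f\text{ an arbitrary vector}\}$, where $f_{\dot W'}$ is the copy of $f_{\dot W}$. *)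

theory Defs
  imports Complex_Main "HOL-Library.Function_Algebras" "HOL-Library.Set_Algebras"
begin

(* All index sets are subsets of one ambient type 'i.  A vector on X is encoded as a function
   on 'i that vanishes outside X.  Hence extending a vector by zero to a larger index set is the
   identity, (f_T, 0_{S - T}) is f_T itself, (f_X, g_Y) for disjoint X, Y is f_X + g_Y, and the
   sum of spaces on different index sets is the elementwise sum of sets from Set_Algebras. *)

definition vecs :: "'i set \<Rightarrow> ('i \<Rightarrow> 'f::field) set" where
  "vecs X = {f. \<forall>i. i \<notin> X \<longrightarrow> f i = 0}"

definition scale_vec :: "'f::field \<Rightarrow> ('i \<Rightarrow> 'f) \<Rightarrow> 'i \<Rightarrow> 'f" where
  "scale_vec c f = (\<lambda>i. c * f i)"

global_interpretation index_vec: vector_space scale_vec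
  by unfold_locales (auto simp: scale_vec_def fun_eq_iff algebra_simps)

definition subspace_on :: "'i set \<Rightarrow> ('i \<Rightarrow> 'f::field) set \<Rightarrow> bool" where
  "subspace_on X V \<longleftrightarrow> V \<subseteq> vecs X \<and> index_vec.subspace V"

(* The vector on X whose i-th entry is the (s i)-th entry of f. *)
definition pullback :: "('i \<Rightarrow> 'i) \<Rightarrow> 'i set \<Rightarrow> ('i \<Rightarrow> 'f::field) \<Rightarrow> 'i \<Rightarrow> 'f" where
  "pullback s X f = (\<lambda>i. if i \<in> X then f (s i) else 0)"

definition restr :: "'i set \<Rightarrow> ('i \<Rightarrow> 'f::field) \<Rightarrow> 'i \<Rightarrow> 'f" where
  "restr T f = (\<lambda>i. if i \<in> T then f i else 0)"

definition restriction :: "('i \<Rightarrow> 'f::field) set \<Rightarrow> 'i set \<Rightarrow> ('i \<Rightarrow> 'f) set"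
    (infixl "\<circ>\<^sub>s" 70) where
  "V \<circ>\<^sub>s T = restr T ` V"

definition contraction :: "('i \<Rightarrow> 'f::field) set \<Rightarrow> 'i set \<Rightarrow> ('i \<Rightarrow> 'f) set"
    (infixl "\<times>\<^sub>s" 70) where
  "V \<times>\<^sub>s T = {f \<in> vecs T. f \<in> V}"

(* "matched X Y VX VY" is VX <-> VY for spaces VX on X and VY on a subset Y of X. *)
definition matched ::
  "'i set \<Rightarrow> 'i set \<Rightarrow> ('i \<Rightarrow> 'f::field) set \<Rightarrow> ('i \<Rightarrow> 'f) set \<Rightarrow> ('i \<Rightarrow> 'f) set" where
  "matched X Y VX VY = {f \<in> vecs (X - Y). \<exists>g\<in>VY. f + g \<in> VX}"

(* The space of all (f_A, - f_A'), where p is the bijection from A onto its copy A'. *)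
definition neg_copy_space :: "'i set \<Rightarrow> 'i set \<Rightarrow> ('i \<Rightarrow> 'i) \<Rightarrow> ('i \<Rightarrow> 'f::field) set" where
  "neg_copy_space A A' p = {f - pullback (inv_into A p) A' f |f. f \<in> vecs A}"

(* Turns a space on A' \<union> B into the corresponding space on A \<union> B, where p is the bijection
   from A onto its copy A'. *)
definition identify_copy ::
  "'i set \<Rightarrow> 'i set \<Rightarrow> ('i \<Rightarrow> 'i) \<Rightarrow> ('i \<Rightarrow> 'f::field) set \<Rightarrow> ('i \<Rightarrow> 'f) set" where
  "identify_copy A B p V = pullback (\<lambda>i. if i \<in> A then p i else i) (A \<union> B) ` V"

end

theory Submission
  imports Defs
begin

text \<open>
  Write \<open>g\<close>, \<open>k\<close>, \<open>v\<close> for vectors of \<open>G\<close>, \<open>K\<close>, \<open>V\<close>. Since extension by zero is the identity, the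
  condition \<open>(G + V) \<times>\<^sub>s (W \<union> Wd) = K\<close> speaks about solutions of the one equation \<open>k = g + v\<close>, and each
  claim comes from solving this equation for another of its three terms and looking at supports:
  \<open>v = k - g\<close> lives on \<open>Wd \<union> My\<close>, so \<open>g\<close> agrees with \<open>k\<close> on \<open>W\<close>, with \<open>- v\<close> on \<open>My\<close>, and vanishes
  on \<open>Mu\<close>.

  The central object is \<open>(G + K) \<times>\<^sub>s (Wd \<union> My)\<close>, the space of all differences \<open>k - g\<close> with this
  support. Under the two conditions on \<open>K\<close> it solves the equation (\<open>sum_with_residual\<close>), and every
  solution that is normalised by the two side conditions of the uniqueness claim coincides with it
  (\<open>normalised_solution_eq\<close>). The normalisation is what prevents \<open>V\<close> from being too small
  (it contains \<open>G \<times>\<^sub>s (Wd \<union> My)\<close>, the directions that \<open>G\<close> itself supplies) or too large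
  (it has no value on \<open>My\<close> that \<open>G\<close> cannot cancel). The copy \<open>Wd'\<close> in the last formula merely
  stores \<open>k - g\<close> on \<open>Wd\<close> in a separate place (\<open>identify_matched_eq\<close>).
\<close>

section \<open>Solvability of the interconnection equation\<close>

lemma subspace_on_contraction_plus:
  assumes "index_vec.subspace G" "index_vec.subspace K"
  shows "subspace_on T ((G + K) \<times>\<^sub>s T)"
proof -
  have "index_vec.subspace (vecs T)"
    by (auto simp: index_vec.subspace_def vecs_def scale_vec_def)
  moreover have "index_vec.subspace (G + K)"
  proof -
    have "G + K = {x + y |x y. x \<in> G \<and> y \<in> K}"
      by (auto simp: set_plus_def)
    then show ?thesis
      using index_vec.subspace_sums[OF assms] by simp
  qed
  moreover have "(G + K) \<times>\<^sub>s T = vecs T \<inter> (G + K)"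
    by (auto simp: contraction_def)
  ultimately show ?thesis
    by (auto simp: subspace_on_def index_vec.subspace_def)
qed

text \<open>This direction of the existence criterion reads \<open>k = g + v\<close> on \<open>W\<close>, where \<open>v\<close> vanishes, and on
  \<open>Mu\<close>, where \<open>k\<close> and \<open>v\<close> both vanish.\<close>

lemma solvable_imp_conditions:
  assumes disj: "W \<inter> Wd = {}" "(W \<union> Wd) \<inter> Mu = {}" "(W \<union> Wd \<union> Mu) \<inter> My = {}"
    and G: "subspace_on (W \<union> Wd \<union> Mu \<union> My) G"
    and V: "subspace_on (Wd \<union> My) V"
    and sol: "(G + V) \<times>\<^sub>s (W \<union> Wd) = K"
  shows "G \<times>\<^sub>s (W \<union> Wd) \<subseteq> K" "K \<circ>\<^sub>s W \<subseteq> G \<times>\<^sub>s (W \<union> Wd \<union> My) \<circ>\<^sub>s W"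
proof -
  have "0 \<in> V"
    using V by (auto simp: subspace_on_def index_vec.subspace_0)
  then have "G \<subseteq> G + V"
    using set_plus_intro[of _ G 0 V] by auto
  then show "G \<times>\<^sub>s (W \<union> Wd) \<subseteq> K"
    using sol by (auto simp: contraction_def)
next
  show "K \<circ>\<^sub>s W \<subseteq> G \<times>\<^sub>s (W \<union> Wd \<union> My) \<circ>\<^sub>s W"
  proof
    fix h assume "h \<in> K \<circ>\<^sub>s W"
    then obtain k where k: "k \<in> K" and h: "h = restr W k"
      by (auto simp: restriction_def)
    have "k \<in> vecs (W \<union> Wd)" "k \<in> G + V"
      using k sol by (auto simp: contraction_def)
    then obtain g v where g: "g \<in> G" and v: "v \<in> V" and eq: "k = g + v"
      and kv: "k \<in> vecs (W \<union> Wd)"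
      by (auto elim: set_plus_elim)
    have vv: "v \<in> vecs (Wd \<union> My)" and gv: "g \<in> vecs (W \<union> Wd \<union> Mu \<union> My)"
      using v V g G by (auto simp: subspace_on_def)
    have "g i = 0" if "i \<notin> W \<union> Wd \<union> My" for i
      using that kv vv eq by (auto simp: vecs_def)
    then have "g \<in> G \<times>\<^sub>s (W \<union> Wd \<union> My)"
      using g by (auto simp: contraction_def vecs_def)
    moreover have "v i = 0" if "i \<in> W" for i
      using that vv disj by (auto simp: vecs_def)
    then have "restr W k = restr W g"
      by (auto simp: restr_def eq fun_eq_iff)
    ultimately show "h \<in> G \<times>\<^sub>s (W \<union> Wd \<union> My) \<circ>\<^sub>s W"
      unfolding restriction_def h by blast
  qed
qed

text \<open>For the inclusion into \<open>K\<close>, a vector \<open>g + (g' + k)\<close> on \<open>W \<union> Wd\<close> differs from \<open>k\<close> by \<open>g + g'\<close>,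
  which has the same support and therefore lies in \<open>G \<times>\<^sub>s (W \<union> Wd) \<subseteq> K\<close>. Conversely, if \<open>g\<close> agrees with
  \<open>k\<close> on \<open>W\<close>, then \<open>k - g\<close> is an admissible choice of \<open>v\<close>.\<close>

lemma sum_with_residual:
  assumes G: "index_vec.subspace G"
    and K: "subspace_on (W \<union> Wd) K"
    and sub: "G \<times>\<^sub>s (W \<union> Wd) \<subseteq> K"
    and sup: "K \<circ>\<^sub>s W \<subseteq> G \<times>\<^sub>s (W \<union> Wd \<union> My) \<circ>\<^sub>s W"
  shows "(G + (G + K) \<times>\<^sub>s (Wd \<union> My)) \<times>\<^sub>s (W \<union> Wd) = K"
proof (intro set_eqI iffI)
  fix f assume "f \<in> (G + (G + K) \<times>\<^sub>s (Wd \<union> My)) \<times>\<^sub>s (W \<union> Wd)"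
  then obtain g g' k where f: "f = g + (g' + k)" and mem: "g \<in> G" "g' \<in> G" "k \<in> K"
    and fv: "f \<in> vecs (W \<union> Wd)"
    by (auto simp: contraction_def elim!: set_plus_elim)
  have "k \<in> vecs (W \<union> Wd)"
    using mem K by (auto simp: subspace_on_def)
  then have "g + g' \<in> vecs (W \<union> Wd)"
    using fv by (auto simp: f vecs_def)
  moreover have "g + g' \<in> G"
    using G mem by (simp add: index_vec.subspace_add)
  ultimately have "g + g' \<in> K"
    using sub by (auto simp: contraction_def)
  then have "(g + g') + k \<in> K"
    using K mem by (simp add: subspace_on_def index_vec.subspace_add)
  then show "f \<in> K"
    by (simp add: f add.assoc)
next
  fix k assume k: "k \<in> K"
  then have "restr W k \<in> G \<times>\<^sub>s (W \<union> Wd \<union> My) \<circ>\<^sub>s W"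
    using sup by (auto simp: restriction_def)
  then obtain g where g: "g \<in> G" "g \<in> vecs (W \<union> Wd \<union> My)" and r: "restr W k = restr W g"
    by (auto simp: restriction_def contraction_def)
  have kv: "k \<in> vecs (W \<union> Wd)"
    using k K by (auto simp: subspace_on_def)
  have "k i = g i" if "i \<in> W" for i
    using fun_cong[OF r, of i] that by (simp add: restr_def)
  then have "(- g + k) i = 0" if "i \<notin> Wd \<union> My" for i
    using that g kv by (cases "i \<in> W") (auto simp: vecs_def)
  then have "- g + k \<in> vecs (Wd \<union> My)"
    by (simp add: vecs_def)
  moreover have "- g + k \<in> G + K"
    using G g k by (intro set_plus_intro index_vec.subspace_neg)
  ultimately have "g + (- g + k) \<in> G + (G + K) \<times>\<^sub>s (Wd \<union> My)"
    using g by (intro set_plus_intro) (auto simp: contraction_def)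
  then show "k \<in> (G + (G + K) \<times>\<^sub>s (Wd \<union> My)) \<times>\<^sub>s (W \<union> Wd)"
    using kv by (simp add: contraction_def)
qed

section \<open>The normalised solution\<close>

text \<open>If \<open>g + k\<close> lives on \<open>Wd \<union> My\<close>, then \<open>g\<close> vanishes on \<open>Mu\<close> and equals \<open>g + k\<close> on \<open>My\<close>, because
  \<open>k\<close> vanishes on both.\<close>

lemma residual_normalised:
  assumes disj: "(W \<union> Wd \<union> Mu) \<inter> My = {}"
    and G: "index_vec.subspace G"
    and K: "subspace_on (W \<union> Wd) K"
  shows "G \<times>\<^sub>s (Wd \<union> My) \<subseteq> (G + K) \<times>\<^sub>s (Wd \<union> My)"
    "(G + K) \<times>\<^sub>s (Wd \<union> My) \<circ>\<^sub>s My \<subseteq> G \<times>\<^sub>s (W \<union> Wd \<union> My) \<circ>\<^sub>s My"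
proof -
  have "0 \<in> K"
    using K by (auto simp: subspace_on_def index_vec.subspace_0)
  then have "G \<subseteq> G + K"
    using set_plus_intro[of _ G 0 K] by auto
  then show "G \<times>\<^sub>s (Wd \<union> My) \<subseteq> (G + K) \<times>\<^sub>s (Wd \<union> My)"
    by (auto simp: contraction_def)
next
  show "(G + K) \<times>\<^sub>s (Wd \<union> My) \<circ>\<^sub>s My \<subseteq> G \<times>\<^sub>s (W \<union> Wd \<union> My) \<circ>\<^sub>s My"
  proof
    fix h assume "h \<in> (G + K) \<times>\<^sub>s (Wd \<union> My) \<circ>\<^sub>s My"
    then obtain g k where g: "g \<in> G" and k: "k \<in> K" and h: "h = restr My (g + k)"
      and v: "g + k \<in> vecs (Wd \<union> My)"
      by (auto simp: restriction_def contraction_def elim!: set_plus_elim)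
    have kv: "k \<in> vecs (W \<union> Wd)"
      using k K by (auto simp: subspace_on_def)
    have "g i = 0" if "i \<notin> W \<union> Wd \<union> My" for i
      using that kv v by (auto simp: vecs_def)
    then have "g \<in> G \<times>\<^sub>s (W \<union> Wd \<union> My)"
      using g by (auto simp: contraction_def vecs_def)
    moreover have "k i = 0" if "i \<in> My" for i
      using that kv disj by (auto simp: vecs_def)
    then have "h = restr My g"
      by (auto simp: h restr_def fun_eq_iff)
    ultimately show "h \<in> G \<times>\<^sub>s (W \<union> Wd \<union> My) \<circ>\<^sub>s My"
      unfolding restriction_def by blast
  qed
qed

text \<open>Each side condition yields one inclusion. Given \<open>v\<close>, the upper bound on \<open>V \<circ>\<^sub>s My\<close> supplies a \<open>g\<close>
  that cancels \<open>v\<close> on \<open>My\<close>, so \<open>v - g\<close> lies in \<open>K\<close>. Given \<open>g + k\<close> on \<open>Wd \<union> My\<close>, writing \<open>k = g' + v\<close>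
  leaves \<open>g + g'\<close> in \<open>G \<times>\<^sub>s (Wd \<union> My)\<close>, which the lower bound absorbs into \<open>V\<close>.\<close>

lemma normalised_solution_eq:
  assumes G: "index_vec.subspace G"
    and V: "subspace_on (Wd \<union> My) V"
    and sol: "(G + V) \<times>\<^sub>s (W \<union> Wd) = K"
    and lower: "G \<times>\<^sub>s (Wd \<union> My) \<subseteq> V"
    and upper: "V \<circ>\<^sub>s My \<subseteq> G \<times>\<^sub>s (W \<union> Wd \<union> My) \<circ>\<^sub>s My"
  shows "V = (G + K) \<times>\<^sub>s (Wd \<union> My)"
proof (intro set_eqI iffI)
  fix v assume v: "v \<in> V"
  then have "restr My v \<in> G \<times>\<^sub>s (W \<union> Wd \<union> My) \<circ>\<^sub>s My"
    using upper by (auto simp: restriction_def)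
  then obtain g where g: "g \<in> G" "g \<in> vecs (W \<union> Wd \<union> My)" and r: "restr My v = restr My g"
    by (auto simp: restriction_def contraction_def)
  have vv: "v \<in> vecs (Wd \<union> My)"
    using v V by (auto simp: subspace_on_def)
  have "v i = g i" if "i \<in> My" for i
    using fun_cong[OF r, of i] that by (simp add: restr_def)
  then have "(- g + v) i = 0" if "i \<notin> W \<union> Wd" for i
    using that g vv by (cases "i \<in> My") (auto simp: vecs_def)
  then have "- g + v \<in> vecs (W \<union> Wd)"
    by (simp add: vecs_def)
  moreover have "- g + v \<in> G + V"
    using G g v by (intro set_plus_intro index_vec.subspace_neg)
  ultimately have "- g + v \<in> K"
    using sol by (auto simp: contraction_def)
  then have "g + (- g + v) \<in> G + K"
    using g by (intro set_plus_intro)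
  then show "v \<in> (G + K) \<times>\<^sub>s (Wd \<union> My)"
    using vv by (simp add: contraction_def)
next
  fix f assume "f \<in> (G + K) \<times>\<^sub>s (Wd \<union> My)"
  then obtain g k where f: "f = g + k" and g: "g \<in> G" and k: "k \<in> K"
    and fv: "f \<in> vecs (Wd \<union> My)"
    by (auto simp: contraction_def elim!: set_plus_elim)
  obtain g' v where k_eq: "k = g' + v" and g': "g' \<in> G" and v: "v \<in> V"
    using k sol by (auto simp: contraction_def elim!: set_plus_elim)
  have "v \<in> vecs (Wd \<union> My)"
    using v V by (auto simp: subspace_on_def)
  then have "g + g' \<in> vecs (Wd \<union> My)"
    using fv by (auto simp: f k_eq vecs_def add.assoc)
  moreover have "g + g' \<in> G"
    using G g g' by (simp add: index_vec.subspace_add)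
  ultimately have "g + g' \<in> V"
    using lower by (auto simp: contraction_def)
  then have "(g + g') + v \<in> V"
    using V v by (simp add: subspace_on_def index_vec.subspace_add)
  then show "f \<in> V"
    by (simp add: f k_eq add.assoc)
qed

section \<open>The formula with a disjoint copy of Wd\<close>

text \<open>The defining equation of a matched vector \<open>h\<close> is \<open>h + k = g + (f - f')\<close>, with \<open>f'\<close> the copy of \<open>f\<close>.
  It says \<open>k = g\<close> on \<open>W\<close>, \<open>g - k = - f\<close> on \<open>Wd\<close>, \<open>h = - f'\<close> on \<open>Wd'\<close>, \<open>h = g\<close> on \<open>My\<close> and \<open>g = 0\<close>
  on \<open>Mu\<close>. So the vector \<open>h\<close> becomes, after \<open>Wd'\<close> is identified with \<open>Wd\<close>, exactly \<open>g - k\<close>, and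
  the support condition on \<open>g - k\<close> is the only constraint that remains.\<close>

lemma identify_matched_eq:
  assumes disj: "W \<inter> Wd = {}" "(W \<union> Wd) \<inter> Mu = {}" "(W \<union> Wd \<union> Mu) \<inter> My = {}"
    and G: "subspace_on (W \<union> Wd \<union> Mu \<union> My) G"
    and K: "subspace_on (W \<union> Wd) K"
    and p: "bij_betw p Wd Wd'"
    and fresh: "Wd' \<inter> (W \<union> Wd \<union> Mu \<union> My) = {}"
  shows "identify_copy Wd My p
           (matched (W \<union> Wd \<union> Wd' \<union> My) (W \<union> Wd)
             ((G + neg_copy_space Wd Wd' p) \<times>\<^sub>s (W \<union> Wd \<union> Wd' \<union> My)) K)
         = (G + K) \<times>\<^sub>s (Wd \<union> My)"
    (is "identify_copy Wd My p ?M = _")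
proof -
  define q where "q = inv_into Wd p"
  define ident :: "('a \<Rightarrow> 'b) \<Rightarrow> 'a \<Rightarrow> 'b"
    where "ident = pullback (\<lambda>i. if i \<in> Wd then p i else i) (Wd \<union> My)"
  have qp: "q (p i) = i" and pW: "p i \<in> Wd'" if "i \<in> Wd" for i
    using p that by (auto simp: q_def bij_betw_def)
  have pq: "p (q i) = i" and qW: "q i \<in> Wd" if "i \<in> Wd'" for i
    using p that by (auto simp: q_def bij_betw_def inv_into_into f_inv_into_f)
  have img: "identify_copy Wd My p ?M = ident ` ?M"
    by (simp add: identify_copy_def ident_def)
  have supp: "W \<union> Wd \<union> Wd' \<union> My - (W \<union> Wd) = Wd' \<union> My"
    using disj fresh by blast
  show ?thesis
  proof (intro set_eqI iffI)
    fix v assume "v \<in> identify_copy Wd My p ?M"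
    then obtain h k g f where v: "v = ident h"
      and hv: "h \<in> vecs (Wd' \<union> My)" and k: "k \<in> K" and g: "g \<in> G"
      and f: "f \<in> vecs Wd" and eq: "h + k = g + (f - pullback q Wd' f)"
      unfolding img
      by (auto simp: matched_def contraction_def neg_copy_space_def supp q_def elim!: set_plus_elim)
    have kv: "k \<in> vecs (W \<union> Wd)" and gv: "g \<in> vecs (W \<union> Wd \<union> Mu \<union> My)"
      using k K g G by (auto simp: subspace_on_def)
    have eq': "h i + k i = g i + (f i - (if i \<in> Wd' then f (q i) else 0))" for i
      using fun_cong[OF eq, of i] by (simp add: pullback_def)
    have "v i = g i - k i" for i
    proof (cases "i \<in> Wd")
      case True
      have "v i = h (p i)"
        using True by (simp add: v ident_def pullback_def)
      also have "\<dots> = - f i"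
      proof -
        have "k (p i) = 0" "g (p i) = 0" "f (p i) = 0"
          using pW[OF True] fresh kv gv f by (auto simp: vecs_def)
        then show ?thesis
          using eq'[of "p i"] pW[OF True] qp[OF True] by simp
      qed
      also have "\<dots> = g i - k i"
      proof -
        have "h i = 0" "i \<notin> Wd'"
          using True hv fresh disj by (auto simp: vecs_def)
        then show ?thesis
          using eq'[of i] by simp
      qed
      finally show ?thesis .
    next
      case False
      have f0: "f i = 0"
        using False f by (simp add: vecs_def)
      show ?thesis
      proof (cases "i \<in> My")
        case True
        then have "k i = 0" "i \<notin> Wd'"
          using kv disj fresh by (auto simp: vecs_def)
        then show ?thesis
          using eq'[of i] True False f0 by (simp add: v ident_def pullback_def)
      next
        case nMy: False
        have "g i = k i"
        proof (cases "i \<in> Wd'")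
          case True
          then have "k i = 0" "g i = 0"
            using kv gv fresh by (auto simp: vecs_def)
          then show ?thesis
            by simp
        next
          case nWd': False
          then have "h i = 0"
            using nMy hv by (simp add: vecs_def)
          then show ?thesis
            using eq'[of i] nWd' f0 by simp
        qed
        then show ?thesis
          using False nMy by (simp add: v ident_def pullback_def)
      qed
    qed
    then have v_eq: "v = g + (- k)"
      by (auto simp: fun_eq_iff)
    have "- k \<in> K"
      using K k by (simp add: subspace_on_def index_vec.subspace_neg)
    then have "v \<in> G + K"
      unfolding v_eq using g by (intro set_plus_intro)
    moreover have "v \<in> vecs (Wd \<union> My)"
      by (auto simp: v ident_def pullback_def vecs_def)
    ultimately show "v \<in> (G + K) \<times>\<^sub>s (Wd \<union> My)"
      by (simp add: contraction_def)
  next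
    fix v assume "v \<in> (G + K) \<times>\<^sub>s (Wd \<union> My)"
    then obtain g k where v: "v = g + k" and g: "g \<in> G" and k: "k \<in> K"
      and vv: "v \<in> vecs (Wd \<union> My)"
      by (auto simp: contraction_def elim!: set_plus_elim)
    have kv: "k \<in> vecs (W \<union> Wd)" and gv: "g \<in> vecs (W \<union> Wd \<union> Mu \<union> My)"
      using k K g G by (auto simp: subspace_on_def)
    \<comment> \<open>The vector \<open>h\<close> is \<open>v\<close> with its \<open>Wd\<close>-part moved to \<open>Wd'\<close>, and \<open>f\<close> is forced by \<open>h = - f'\<close>.\<close>
    define h where "h = (\<lambda>i. if i \<in> Wd' then v (q i) else if i \<in> My then v i else 0)"
    define f where "f = - restr Wd v"
    have eq: "h + (- k) = g + (f - pullback q Wd' f)"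
    proof
      fix i
      consider "i \<in> Wd'" | "i \<in> Wd" "i \<notin> Wd'" "i \<notin> My" | "i \<in> My" "i \<notin> Wd" "i \<notin> Wd'"
        | "i \<notin> Wd'" "i \<notin> Wd" "i \<notin> My"
        using disj by blast
      then show "(h + (- k)) i = (g + (f - pullback q Wd' f)) i"
      proof cases
        case 1
        then have "k i = 0" "g i = 0" "i \<notin> Wd"
          using kv gv fresh by (auto simp: vecs_def)
        then show ?thesis
          using 1 qW[OF 1] by (simp add: h_def f_def pullback_def restr_def)
      next
        case 2
        then show ?thesis
          by (simp add: h_def f_def pullback_def restr_def v)
      next
        case 3
        then have "k i = 0"
          using kv disj by (auto simp: vecs_def)
        then show ?thesis
          using 3 by (simp add: h_def f_def pullback_def restr_def v)
      next
        case 4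
        then have "g i + k i = 0"
          using vv by (simp add: vecs_def v)
        then have "g i = - k i"
          by (simp add: eq_neg_iff_add_eq_0)
        then show ?thesis
          using 4 by (simp add: h_def f_def pullback_def restr_def)
      qed
    qed
    have hv: "h \<in> vecs (Wd' \<union> My)"
      by (simp add: h_def vecs_def)
    have nk: "- k \<in> K"
      using K k by (simp add: subspace_on_def index_vec.subspace_neg)
    have "f \<in> vecs Wd"
      by (simp add: f_def vecs_def restr_def)
    then have "f - pullback q Wd' f \<in> neg_copy_space Wd Wd' p"
      by (auto simp: neg_copy_space_def q_def)
    then have "h + (- k) \<in> G + neg_copy_space Wd Wd' p"
      unfolding eq using g by (intro set_plus_intro)
    moreover have "h + (- k) \<in> vecs (W \<union> Wd \<union> Wd' \<union> My)"
      using hv kv by (auto simp: vecs_def)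
    ultimately have "h \<in> ?M"
      unfolding matched_def supp contraction_def using hv nk by blast
    moreover have "v = ident h"
    proof
      fix i
      show "v i = ident h i"
        using qp[of i] pW[of i] vv fresh
        by (auto simp: ident_def pullback_def h_def vecs_def)
    qed
    ultimately show "v \<in> identify_copy Wd My p ?M"
      unfolding img by blast
  qed
qed

section \<open>Existence, uniqueness and explicit form\<close>

theorem theorem38:
  fixes W Wd Mu My :: "'i set"
    and dot :: "'i \<Rightarrow> 'i"
    and G K :: "('i \<Rightarrow> 'f::field) set"
  assumes "finite W" "finite Wd" "finite Mu" "finite My"
    and "W \<inter> Wd = {}" "(W \<union> Wd) \<inter> Mu = {}" "(W \<union> Wd \<union> Mu) \<inter> My = {}"
    and "bij_betw dot W Wd"
    and "subspace_on (W \<union> Wd \<union> Mu \<union> My) G"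
    and "subspace_on (W \<union> Wd) K"
  shows
    "((\<exists>V. subspace_on (Wd \<union> My) V \<and> (G + V) \<times>\<^sub>s (W \<union> Wd) = K)
        \<longleftrightarrow> G \<times>\<^sub>s (W \<union> Wd) \<subseteq> K \<and> G \<times>\<^sub>s (W \<union> Wd \<union> My) \<circ>\<^sub>s W \<supseteq> K \<circ>\<^sub>s W)
   \<and> ((\<exists>V. subspace_on (Wd \<union> My) V \<and> (G + V) \<times>\<^sub>s (W \<union> Wd) = K) \<longrightarrow>
        (\<exists>!V. subspace_on (Wd \<union> My) V \<and> (G + V) \<times>\<^sub>s (W \<union> Wd) = K
            \<and> G \<times>\<^sub>s (Wd \<union> My) \<subseteq> V \<and> G \<times>\<^sub>s (W \<union> Wd \<union> My) \<circ>\<^sub>s My \<supseteq> V \<circ>\<^sub>s My)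
      \<and> (\<forall>V. subspace_on (Wd \<union> My) V \<and> (G + V) \<times>\<^sub>s (W \<union> Wd) = K
            \<and> G \<times>\<^sub>s (Wd \<union> My) \<subseteq> V \<and> G \<times>\<^sub>s (W \<union> Wd \<union> My) \<circ>\<^sub>s My \<supseteq> V \<circ>\<^sub>s My \<longrightarrow>
            V = (G + K) \<times>\<^sub>s (Wd \<union> My)
          \<and> (\<forall>Wd' p. bij_betw p Wd Wd' \<and> Wd' \<inter> (W \<union> Wd \<union> Mu \<union> My) = {} \<longrightarrow>
              V = identify_copy Wd My p
                    (matched (W \<union> Wd \<union> Wd' \<union> My) (W \<union> Wd)
                      ((G + neg_copy_space Wd Wd' p) \<times>\<^sub>s (W \<union> Wd \<union> Wd' \<union> My)) K))))"
proof -
  note disj = assms(5-7) and G = assms(9) and K = assms(10)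
  have Gs: "index_vec.subspace G" and Ks: "index_vec.subspace K"
    using G K by (auto simp: subspace_on_def)
  let ?R = "(G + K) \<times>\<^sub>s (Wd \<union> My)"
  let ?sol = "\<lambda>V. subspace_on (Wd \<union> My) V \<and> (G + V) \<times>\<^sub>s (W \<union> Wd) = K"
  let ?norm_sol = "\<lambda>V. subspace_on (Wd \<union> My) V \<and> (G + V) \<times>\<^sub>s (W \<union> Wd) = K
    \<and> G \<times>\<^sub>s (Wd \<union> My) \<subseteq> V \<and> V \<circ>\<^sub>s My \<subseteq> G \<times>\<^sub>s (W \<union> Wd \<union> My) \<circ>\<^sub>s My"
  let ?cond = "G \<times>\<^sub>s (W \<union> Wd) \<subseteq> K \<and> K \<circ>\<^sub>s W \<subseteq> G \<times>\<^sub>s (W \<union> Wd \<union> My) \<circ>\<^sub>s W"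
  have necessary: ?cond if "\<exists>V. ?sol V"
    using that solvable_imp_conditions[OF disj G] by blast
  have sufficient: "?sol ?R" if ?cond
    using that sum_with_residual[OF Gs K] subspace_on_contraction_plus[OF Gs Ks] by blast
  have normalised: "?norm_sol ?R" if ?cond
    using sufficient[OF that] residual_normalised[OF disj(3) Gs K] by blast
  have determined: "V = ?R" if "?norm_sol V" for V
    using that normalised_solution_eq[OF Gs] by blast
  have existence: "(\<exists>V. ?sol V) \<longleftrightarrow> ?cond"
    using necessary sufficient by blast
  have unique: "\<exists>!V. ?norm_sol V" if "\<exists>V. ?sol V"
    using normalised[OF necessary[OF that]] determined by blast
  have formula: "V = ?R \<and> (\<forall>Wd' p. bij_betw p Wd Wd' \<and> Wd' \<inter> (W \<union> Wd \<union> Mu \<union> My) = {} \<longrightarrow>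
      V = identify_copy Wd My p
            (matched (W \<union> Wd \<union> Wd' \<union> My) (W \<union> Wd)
              ((G + neg_copy_space Wd Wd' p) \<times>\<^sub>s (W \<union> Wd \<union> Wd' \<union> My)) K))"
    if "?norm_sol V" for V
    using determined[OF that] identify_matched_eq[OF disj G K] by simp
  show ?thesis
    by (intro conjI[OF existence] impI conjI[OF unique]) (assumption, intro allI impI, rule formula)
qed

end
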